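(* Let $G$ be an ADMG with vertex set $V$ and let $\prec$ be an ordering of $V$ consistent with $G$. Suppose that for a vertex $x \in V$ the following two conditions hold: (a) all vertices in $\mathrm{dis}_G(x) \cap \mathrm{pre}_{G,\prec}(x)$ are consecutive in $\prec$; and (b) for any two vertices $\alpha, \beta$ in $\mathrm{dis}_G(x) \cap \mathrm{pre}_{G,\prec}(x)$, there is no directed edge between $\alpha$ and $\beta$. Then: (1) Every vertex $y \in \mathrm{dis}_G(x) \cap \mathrm{pre}_{G,\prec}(x)$ is m-separated from $V \setminus \mathrm{f}(y,G)$ given $\mathrm{pa}_G(y)$ in $G$. (2) Let $P$ be a joint probability distribution of random variables indexed by $V$ that satisfies the composition axiom. If for all $y \in \mathrm{dis}_G(x) \cap \mathrm{pre}_{G,\prec}(x)$ the relation $I(\{y\}, \mathrm{pa}_G(y), V \setminus \mathrm{f}(y,G))$ holds in $P$, then for any maximal ancestral set $A$ such that $x \in A \subseteq \mathrm{pre}_{G,\prec}(x)$ the relation $I(\{x\}, \mathrm{mb}(x,A), A \setminus (\mathrm{mb}(x,A) \cup \{x\}))$ holds in $P$.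
   Context: An acyclic directed mixed graph (ADMG) $G$ is a finite graph whose edges are directed ($\to$) or bi-directed ($\leftrightarrow$) and which has no directed cycle (consisting of $\to$ edges). A pair of vertices may be joined by both a directed and a bi-directed edge, so a path is specified by its sequence of edges as well as of (distinct) vertices. For a vertex $x$: $\mathrm{pa}_G(x) = \{v : v \to x \text{ in } G\}$ (parents); $\mathrm{sp}_G(x) = \{v : v \leftrightarrow x \text{ in } G\}$ (spouses); $\mathrm{an}_G(x) = \{v : v \to \cdots \to x \text{ in } G \text{ or } v = x\}$ (ancestors); $\mathrm{de}_G(x) = \{v : v \leftarrow \cdots \leftarrow x \text{ in } G \text{ or } v = x\}$ (descendants); $\mathrm{dis}_G(x) = \{v : v \leftrightarrow \cdots \leftrightarrow x \text{ in } G \text{ or } v = x\}$ (district). The first four are extended to sets of vertices by unions. Put $\mathrm{f}(x,G) = \mathrm{pa}_G(x) \cup \mathrm{de}_G(\{x\} \cup \mathrm{sp}_G(x))$. A (strict total) ordering $\prec$ on $V$ is consistent with $G$ if $x \prec y \Rightarrow y \notin \mathrm{an}_G(x)$. Put $\mathrm{pre}_{G,\prec}(x) = \{v : v \prec x \text{ or } v = x\}$. A set of vertices is consecutive in $\prec$ if no vertex outside the set lies strictly between two of its members in $\prec$. A set $A \subseteq V$ is ancestral if $\mathrm{an}_G(A) = A$. $G_A$ is the induced subgraph of $G$ on $A$. If $A$ is ancestral and $x \in A$ has no children in $A$, the Markov blanket of $x$ with respect to the induced subgraph on $A$ is $\mathrm{mb}(x,A) = \mathrm{pa}_{G_A}(\mathrm{dis}_{G_A}(x))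 \cup (\mathrm{dis}_{G_A}(x) \setminus \{x\})$. An ancestral set $A$ with $x \in A \subseteq \mathrm{pre}_{G,\prec}(x)$ is maximal (with respect to the Markov blanket $\mathrm{mb}(x,A)$) if, whenever $B$ is an ancestral set with $A \subseteq B \subseteq \mathrm{pre}_{G,\prec}(x)$ and $\mathrm{mb}(x,A) = \mathrm{mb}(x,B)$, then $A = B$. A non-endpoint vertex $z$ on a path is a collider if two arrowheads on the path meet at $z$ ($\to z \leftarrow$, $\leftrightarrow z \leftrightarrow$, $\leftrightarrow z \leftarrow$, $\to z \leftrightarrow$); all other non-endpoint vertices are non-colliders. A path between two vertices is m-connecting given a set $Z$ if every non-collider on the path is not in $Z$ and every collider on the path is an ancestor of a vertex in $Z$. Two vertices are m-separated given $Z$ if no path between them is m-connecting given $Z$; a vertex is m-separated from a set given $Z$ if it is m-separated from each element of the set given $Z$. For disjoint $X,Y,Z \subseteq V$, $I(X,Z,Y)$ denotes that $X$ is conditionally independent of $Y$ given $Z$ under the distribution considered (trivially true if $X$ or $Y$ is empty). $P$ satisfies the composition axiom if for all pairwise disjoint $X,Y,Z,W \subseteq V$: $I(X,Z,Y)$ and $I(X,Z,W)$ together imply $I(X,Z,Y\cup W)$. *)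

theory Defs
  imports "HOL-Probability.Probability"
begin

text \<open>A bi-directed edge between u and v is stored as both ordered pairs (u, v) and (v, u).\<close>

record 'v mixed_graph =
  verts :: "'v set"
  dir :: "('v \<times> 'v) set"
  bidir :: "('v \<times> 'v) set"

definition admg :: "'v mixed_graph \<Rightarrow> bool" where
  "admg G \<longleftrightarrow>
     finite (verts G) \<and>
     dir G \<subseteq> verts G \<times> verts G \<and> acyclic (dir G) \<and>
     bidir G \<subseteq> verts G \<times> verts G \<and> sym (bidir G) \<and> irrefl (bidir G)"

definition parents :: "'v mixed_graph \<Rightarrow> 'v \<Rightarrow> 'v set" where
  "parents G x = {v. (v, x) \<in> dir G}"

definition spouses :: "'v mixed_graph \<Rightarrow> 'v \<Rightarrow> 'v set" where
  "spouses G x = {v. (v, x) \<in> bidir G}"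

definition ancestors :: "'v mixed_graph \<Rightarrow> 'v \<Rightarrow> 'v set" where
  "ancestors G x = {v. (v, x) \<in> (dir G)\<^sup>*}"

definition descendants :: "'v mixed_graph \<Rightarrow> 'v \<Rightarrow> 'v set" where
  "descendants G x = {v. (x, v) \<in> (dir G)\<^sup>*}"

definition district :: "'v mixed_graph \<Rightarrow> 'v \<Rightarrow> 'v set" where
  "district G x = {v. (v, x) \<in> (bidir G)\<^sup>*}"

definition f_set :: "'v mixed_graph \<Rightarrow> 'v \<Rightarrow> 'v set" where
  "f_set G x = parents G x \<union> (\<Union>v \<in> {x} \<union> spouses G x. descendants G v)"

definition induced :: "'v mixed_graph \<Rightarrow> 'v set \<Rightarrow> 'v mixed_graph" where
  "induced G A =
     \<lparr> verts = verts G \<inter> A, dir = dir G \<inter> A \<times> A, bidir = bidir G \<inter> A \<times> A \<rparr>"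


text \<open>A vertex ordering is a strict relation r, where (u, v) in r means that u precedes v.\<close>

definition vertex_ordering :: "'v mixed_graph \<Rightarrow> ('v \<times> 'v) set \<Rightarrow> bool" where
  "vertex_ordering G r \<longleftrightarrow>
     r \<subseteq> verts G \<times> verts G \<and> strict_linear_order_on (verts G) r"

definition consistent :: "'v mixed_graph \<Rightarrow> ('v \<times> 'v) set \<Rightarrow> bool" where
  "consistent G r \<longleftrightarrow> (\<forall>x y. (x, y) \<in> r \<longrightarrow> y \<notin> ancestors G x)"

definition pre :: "('v \<times> 'v) set \<Rightarrow> 'v \<Rightarrow> 'v set" where
  "pre r x = {v. (v, x) \<in> r \<or> v = x}"

definition consecutive :: "'v mixed_graph \<Rightarrow> ('v \<times> 'v) set \<Rightarrow> 'v set \<Rightarrow> bool" where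
  "consecutive G r S \<longleftrightarrow>
     (\<forall>a \<in> S. \<forall>b \<in> S. \<forall>v \<in> verts G - S. \<not> ((a, v) \<in> r \<and> (v, b) \<in> r))"


definition ancestral :: "'v mixed_graph \<Rightarrow> 'v set \<Rightarrow> bool" where
  "ancestral G A \<longleftrightarrow> A \<subseteq> verts G \<and> (\<Union>v \<in> A. ancestors G v) = A"

text \<open>
  Meaningful when A is ancestral and x is in A without children in A; the latter holds whenever A
  is contained in the predecessors of x (including x) in a consistent ordering.
\<close>

definition markov_blanket :: "'v mixed_graph \<Rightarrow> 'v \<Rightarrow> 'v set \<Rightarrow> 'v set" where
  "markov_blanket G x A =
     (\<Union>v \<in> district (induced G A) x. parents (induced G A) v)
       \<union> (district (induced G A) x - {x})"

definition maximal_ancestral ::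
  "'v mixed_graph \<Rightarrow> ('v \<times> 'v) set \<Rightarrow> 'v \<Rightarrow> 'v set \<Rightarrow> bool" where
  "maximal_ancestral G r x A \<longleftrightarrow>
     ancestral G A \<and> x \<in> A \<and> A \<subseteq> pre r x \<and>
     (\<forall>B. ancestral G B \<and> A \<subseteq> B \<and> B \<subseteq> pre r x \<and>
          markov_blanket G x A = markov_blanket G x B \<longrightarrow> A = B)"


text \<open>
  A path is a list of distinct vertices together with the list of the edges traversed, since two
  adjacent vertices may be joined by both a directed and a bi-directed edge.
  Constructors give the edge as seen in the direction of travel.
\<close>

datatype edge = Forward | Backward | Bidirected

fun joins :: "'v mixed_graph \<Rightarrow> 'v \<Rightarrow> edge \<Rightarrow> 'v \<Rightarrow> bool" where
  "joins G u Forward v \<longleftrightarrow> (u, v) \<in> dir G"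
| "joins G u Backward v \<longleftrightarrow> (v, u) \<in> dir G"
| "joins G u Bidirected v \<longleftrightarrow> (u, v) \<in> bidir G"

definition is_path :: "'v mixed_graph \<Rightarrow> 'v list \<Rightarrow> edge list \<Rightarrow> bool" where
  "is_path G vs es \<longleftrightarrow>
     length vs = Suc (length es) \<and> distinct vs \<and> set vs \<subseteq> verts G \<and>
     (\<forall>i < length es. joins G (vs ! i) (es ! i) (vs ! Suc i))"

text \<open>
  The non-endpoint vertices are those at positions Suc i with Suc i < length es; such a vertex is
  entered through edge i and left through edge Suc i.
\<close>

definition collider :: "edge list \<Rightarrow> nat \<Rightarrow> bool" where
  "collider es i \<longleftrightarrow> es ! i \<in> {Forward, Bidirected} \<and> es ! Suc i \<in> {Backward, Bidirected}"

definition m_connecting ::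
  "'v mixed_graph \<Rightarrow> 'v set \<Rightarrow> 'v list \<Rightarrow> edge list \<Rightarrow> bool" where
  "m_connecting G Z vs es \<longleftrightarrow>
     (\<forall>i. Suc i < length es \<longrightarrow>
        (\<not> collider es i \<longrightarrow> vs ! Suc i \<notin> Z) \<and>
        (collider es i \<longrightarrow> vs ! Suc i \<in> (\<Union>z \<in> Z. ancestors G z)))"

definition m_separated :: "'v mixed_graph \<Rightarrow> 'v \<Rightarrow> 'v \<Rightarrow> 'v set \<Rightarrow> bool" where
  "m_separated G u v Z \<longleftrightarrow>
     \<not> (\<exists>vs es. is_path G vs es \<and> hd vs = u \<and> last vs = v \<and> m_connecting G Z vs es)"

definition m_separated_set :: "'v mixed_graph \<Rightarrow> 'v \<Rightarrow> 'v set \<Rightarrow> 'v set \<Rightarrow> bool" where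
  "m_separated_set G u S Z \<longleftrightarrow> (\<forall>v \<in> S. m_separated G u v Z)"


text \<open>
  A joint distribution of random variables indexed by V is a probability measure P on the product
  of measurable spaces N v; the random variable with index v is the coordinate map at v.
\<close>

definition joint_distribution ::
  "'v set \<Rightarrow> ('v \<Rightarrow> 'a measure) \<Rightarrow> ('v \<Rightarrow> 'a) measure \<Rightarrow> bool" where
  "joint_distribution V N P \<longleftrightarrow> prob_space P \<and> sets P = sets (Pi\<^sub>M V N)"

text \<open>The sigma-algebra on the space of P generated by the coordinates with index in S.\<close>

definition coord_algebra ::
  "('v \<Rightarrow> 'a measure) \<Rightarrow> ('v \<Rightarrow> 'a) measure \<Rightarrow> 'v set \<Rightarrow> ('v \<Rightarrow> 'a) measure" where
  "coord_algebra N P S = vimage_algebra (space P) (\<lambda>\<omega>. restrict \<omega> S) (Pi\<^sub>M S N)"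

text \<open>
  Argument order as in I(X, Z, Y): X and Y are independent given the middle argument Z, that is,
  P(E \<inter> F | Z) = P(E | Z) P(F | Z) almost surely for all events E of X and F of Y.
\<close>

definition cond_indep ::
  "('v \<Rightarrow> 'a measure) \<Rightarrow> ('v \<Rightarrow> 'a) measure \<Rightarrow> 'v set \<Rightarrow> 'v set \<Rightarrow> 'v set \<Rightarrow> bool" where
  "cond_indep N P X Z Y \<longleftrightarrow>
     (\<forall>E \<in> sets (coord_algebra N P X). \<forall>F \<in> sets (coord_algebra N P Y).
        AE \<omega> in P.
          real_cond_exp P (coord_algebra N P Z) (indicat_real (E \<inter> F)) \<omega> =
          real_cond_exp P (coord_algebra N P Z) (indicat_real E) \<omega> *
          real_cond_exp P (coord_algebra N P Z) (indicat_real F) \<omega>)"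

definition composition_axiom ::
  "'v set \<Rightarrow> ('v \<Rightarrow> 'a measure) \<Rightarrow> ('v \<Rightarrow> 'a) measure \<Rightarrow> bool" where
  "composition_axiom V N P \<longleftrightarrow>
     (\<forall>X Y Z W.
        X \<subseteq> V \<and> Y \<subseteq> V \<and> Z \<subseteq> V \<and> W \<subseteq> V \<and>
        X \<inter> Y = {} \<and> X \<inter> Z = {} \<and> X \<inter> W = {} \<and> Y \<inter> Z = {} \<and> Y \<inter> W = {} \<and> Z \<inter> W = {} \<longrightarrow>
        cond_indep N P X Z Y \<longrightarrow> cond_indep N P X Z W \<longrightarrow> cond_indep N P X Z (Y \<union> W))"

end

theory Submission
  imports Defs
begin

text \<open>
  The two hypotheses exclude every nontrivial directed path from the district of x into the
  predecessors of x. Hence a path that leaves y other than through a parent either consists of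
  directed edges away from y or a spouse of y, or has a collider that is not an ancestor of y;
  this gives the m-separation. For the second part, let D be the district of x inside A and Q the
  set of parents of D. For y in D the local independence yields that y is independent of the rest
  R of A and of the remaining parents in Q given its own parents, hence of R given Q by weak
  union. Composition gives that D is independent of R given Q, and weak union moves all of D
  except x into the conditioning set.
\<close>

section \<open>Directed paths inside a district\<close>

locale consecutive_district =
  fixes G :: "'v mixed_graph" and r :: "('v \<times> 'v) set" and x :: 'v
  assumes admg: "admg G"
    and ordering: "vertex_ordering G r"
    and consistent: "consistent G r"
    and x_in: "x \<in> verts G"
    and consecutive: "consecutive G r (district G x \<inter> pre r x)"
    and no_edge: "\<forall>a \<in> district G x \<inter> pre r x. \<forall>b \<in> district G x \<inter> pre r x. (a, b) \<notin> dir G"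
begin

lemma r_facts: "r \<subseteq> verts G \<times> verts G" "trans r" "total_on (verts G) r"
  using ordering by (auto simp: vertex_ordering_def strict_linear_order_on_def)

lemma dir_subset: "dir G \<subseteq> verts G \<times> verts G"
  and sym_bidir: "sym (bidir G)"
  using admg by (auto simp: admg_def)

lemma pre_subset_verts: "pre r x \<subseteq> verts G"
  using x_in r_facts(1) by (auto simp: pre_def)

text \<open>Consistency only rules out \<open>(b, a) \<in> r\<close>. Both ends of a nontrivial path
  lie on an edge, hence are vertices, and totality of \<open>r\<close> then decides the
  order.\<close>

lemma rtrancl_dir_imp_less:
  assumes "(a, b) \<in> (dir G)\<^sup>*" "a \<noteq> b"
  shows "(a, b) \<in> r"
proof -
  have "a \<in> verts G" using assms dir_subset by (auto elim: converse_rtranclE)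
  moreover have "b \<in> verts G" using assms dir_subset by (auto elim: rtranclE)
  moreover have "(b, a) \<notin> r"
    using consistent assms(1) by (auto simp: consistent_def ancestors_def)
  ultimately show ?thesis
    using r_facts(3) assms(2) by (auto simp: total_on_def)
qed

lemma pre_downward:
  assumes "(a, b) \<in> (dir G)\<^sup>*" "b \<in> pre r x"
  shows "a \<in> pre r x"
proof (cases "a = b")
  case False
  then show ?thesis
    using rtrancl_dir_imp_less[OF assms(1)] assms(2) r_facts(2)
    by (auto simp: pre_def dest: transD)
qed (use assms in simp)

lemma district_sym_closed:
  assumes "a \<in> district G x" "(a, b) \<in> bidir G"
  shows "b \<in> district G x"
  using assms sym_bidir unfolding district_def
  by (auto intro: converse_rtrancl_into_rtrancl dest: symD)

lemma x_in_block: "x \<in> district G x \<inter> pre r x"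
  by (simp add: district_def pre_def)

text \<open>By consecutiveness, the second vertex of a directed path from the district into the
  predecessors of x would itself lie in the district.\<close>

lemma no_directed_path_from_district:
  assumes a: "a \<in> district G x" and ab: "(a, b) \<in> (dir G)\<^sup>*" and b: "b \<in> pre r x"
  shows "a = b"
proof (rule ccontr)
  assume "a \<noteq> b"
  with ab obtain c where ac: "(a, c) \<in> dir G" and cb: "(c, b) \<in> (dir G)\<^sup>*"
    by (auto elim: converse_rtranclE)
  have a_in: "a \<in> district G x \<inter> pre r x"
    using a pre_downward[OF ab b] by simp
  have c_pre: "c \<in> pre r x"
    by (rule pre_downward[OF cb b])
  have "a \<noteq> c" using ac admg by (auto simp: admg_def acyclic_def)
  then have "(a, c) \<in> r" using rtrancl_dir_imp_less ac by blast
  moreover have c_notin: "c \<notin> district G x \<inter> pre r x"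
    using no_edge a_in ac by blast
  \<comment> \<open>The block contains \<open>x\<close> but not \<open>c\<close>, so
    \<open>c\<close> precedes \<open>x\<close> strictly and lies strictly between the block members
    \<open>a\<close> and \<open>x\<close>.\<close>
  moreover have "(c, x) \<in> r"
    using c_pre c_notin x_in_block by (auto simp: pre_def)
  moreover have "c \<in> verts G" using c_pre pre_subset_verts by blast
  ultimately show False
    using consecutive a_in x_in_block unfolding consecutive_def by blast
qed

section \<open>m-separation\<close>

text \<open>A connecting path is followed edge by edge from \<open>y\<close>: after the first edge
  all its edges point forward, so its end descends from \<open>y\<close> or from a spouse of
  \<open>y\<close> and belongs to \<open>f_set G y\<close>.\<close>

lemma m_separated_parents:
  assumes y: "y \<in> district G x \<inter> pre r x"
  shows "m_separated_set G y (verts G - f_set G y) (parents G y)"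
  unfolding m_separated_set_def m_separated_def
proof (intro ballI notI, elim exE conjE)
  fix v vs es
  assume v: "v \<in> verts G - f_set G y" and path: "is_path G vs es"
    and hd: "hd vs = y" and last: "last vs = v"
    and conn: "m_connecting G (parents G y) vs es"
  have len: "length vs = Suc (length es)"
    and joins: "\<And>i. i < length es \<Longrightarrow> joins G (vs ! i) (es ! i) (vs ! Suc i)"
    using path by (auto simp: is_path_def)
  have "vs \<noteq> []" using len by auto
  then have vs0: "vs ! 0 = y" and vsn: "vs ! length es = v"
    using hd last len by (simp_all add: hd_conv_nth last_conv_nth)
  have "y \<in> f_set G y" by (simp add: f_set_def descendants_def)
  then have "es \<noteq> []" using v vs0 vsn by auto
  \<comment> \<open>A backward first edge leads to a parent of \<open>y\<close>. As an inner vertex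
    this parent is a non-collider in the conditioning set; as the endpoint it lies in
    \<open>f_set G y\<close>.\<close>
  have first: "es ! 0 \<noteq> Backward"
  proof
    assume bw: "es ! 0 = Backward"
    then have p: "vs ! 1 \<in> parents G y"
      using joins[of 0] \<open>es \<noteq> []\<close> vs0 by (simp add: parents_def)
    show False
    proof (cases "Suc 0 < length es")
      case True
      moreover have "\<not> collider es 0" using bw by (simp add: collider_def)
      ultimately show False using conn p by (auto simp: m_connecting_def)
    next
      case False
      then have "length es = 1" using \<open>es \<noteq> []\<close> by (cases es) auto
      then have "v \<in> f_set G y" using p vsn by (simp add: f_set_def)
      then show False using v by simp
    qed
  qed
  \<comment> \<open>\<open>w\<close> is the vertex where the directed part of the path starts:
    \<open>y\<close> itself, or the spouse reached by a bi-directed first edge.\<close>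
  define w where "w = (if es ! 0 = Forward then y else vs ! 1)"
  have w: "w \<in> {y} \<union> spouses G y" and w_dist: "w \<in> district G x"
    and w_desc: "(w, vs ! 1) \<in> (dir G)\<^sup>*"
  proof -
    have *: "es ! 0 = Forward \<and> (y, vs ! 1) \<in> dir G \<or> es ! 0 = Bidirected \<and> (y, vs ! 1) \<in> bidir G"
      using joins[of 0] \<open>es \<noteq> []\<close> vs0 first by (cases "es ! 0") auto
    then show "w \<in> {y} \<union> spouses G y" "(w, vs ! 1) \<in> (dir G)\<^sup>*"
      using sym_bidir by (auto simp: w_def spouses_def dest: symD)
    show "w \<in> district G x"
      using * y district_sym_closed by (auto simp: w_def)
  qed
  \<comment> \<open>Otherwise a nonempty directed path would run from \<open>w\<close> through
    \<open>d\<close> to \<open>y\<close>. Both ends lie in the district, so \<open>w = y\<close>,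
    which closes a directed cycle.\<close>
  have w_no: "d \<notin> (\<Union>z \<in> parents G y. ancestors G z)" if "(w, d) \<in> (dir G)\<^sup>*" for d
  proof
    assume "d \<in> (\<Union>z \<in> parents G y. ancestors G z)"
    then obtain p where p: "(d, p) \<in> (dir G)\<^sup>*" "(p, y) \<in> dir G"
      by (auto simp: parents_def ancestors_def)
    then have "(w, y) \<in> (dir G)\<^sup>+" using that by (meson rtrancl_trans rtrancl_into_trancl1)
    moreover from this have "w = y"
      using no_directed_path_from_district[OF w_dist, of y] y by (auto dest: trancl_into_rtrancl)
    ultimately show False using admg by (auto simp: admg_def acyclic_def)
  qed
  text \<open>The first edge that is not directed forward would create a collider that descends from w,
    hence not an ancestor of a parent of y.\<close>
  have walk: "i < length es \<Longrightarrow> (w, vs ! Suc i) \<in> (dir G)\<^sup>* \<and> es ! i \<noteq> Backward" for i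
  proof (induction i)
    case 0
    then show ?case using w_desc first by simp
  next
    case (Suc i)
    then have IH: "(w, vs ! Suc i) \<in> (dir G)\<^sup>*" "es ! i \<noteq> Backward" by auto
    have "es ! Suc i = Forward"
    proof (rule ccontr)
      assume "es ! Suc i \<noteq> Forward"
      then have "collider es i"
        using IH(2) by (cases "es ! i"; cases "es ! Suc i") (auto simp: collider_def)
      then show False
        using conn Suc.prems w_no[OF IH(1)] by (auto simp: m_connecting_def)
    qed
    then show ?case
      using joins[OF Suc.prems] IH(1) by (auto intro: rtrancl_into_rtrancl)
  qed
  have "(w, v) \<in> (dir G)\<^sup>*"
    using walk[of "length es - 1"] \<open>es \<noteq> []\<close> vsn by simp
  then have "v \<in> f_set G y"
    using w by (auto simp: f_set_def descendants_def)
  then show False using v by simp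
qed

end

section \<open>Conditional independence of events\<close>

lemma (in prob_space) sigma_finite_subalgebraI:
  "subalgebra M C \<Longrightarrow> sigma_finite_subalgebra M C"
  by (intro finite_measure_subalgebra_is_sigma_finite finite_measure_subalgebra.intro
      finite_measure_subalgebra_axioms.intro finite_measure_axioms)

lemma (in prob_space) integrable_indicator_event:
  "E \<in> events \<Longrightarrow> integrable M (indicat_real E)"
  by (simp add: less_top[symmetric])

text \<open>The conclusion says that the conditional probability of E given C and B jointly is
  already C-measurable.\<close>

lemma (in prob_space) cond_indep_imp_set_integral_eq:
  assumes C: "subalgebra M C" and B: "subalgebra M B" and E: "E \<in> events"
    and indep: "\<And>F. F \<in> sets B \<Longrightarrow> AE \<omega> in M.
          real_cond_exp M C (indicat_real (E \<inter> F)) \<omega> =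
          real_cond_exp M C (indicat_real E) \<omega> * real_cond_exp M C (indicat_real F) \<omega>"
    and K: "K \<in> sigma_sets (space M) {H \<inter> F |H F. H \<in> sets C \<and> F \<in> sets B}"
  shows "(\<integral>\<omega>. indicat_real K \<omega> * indicat_real E \<omega> \<partial>M) =
         (\<integral>\<omega>. indicat_real K \<omega> * real_cond_exp M C (indicat_real E) \<omega> \<partial>M)"
proof -
  interpret C: sigma_finite_subalgebra M C by (rule sigma_finite_subalgebraI[OF C])
  define g where "g = real_cond_exp M C (indicat_real E)"
  let ?G = "{H \<inter> F |H F. H \<in> sets C \<and> F \<in> sets B}"
  have CM: "sets C \<subseteq> events" and BM: "sets B \<subseteq> events" and spC: "space C = space M"
    and spB: "space B = space M"
    using B C by (auto simp: subalgebra_def)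
  have intE: "integrable M (indicat_real E)"
    by (rule integrable_indicator_event[OF E])
  have intg: "integrable M g" unfolding g_def by (rule C.real_cond_exp_int(1)[OF intE])
  have gC: "g \<in> borel_measurable C" unfolding g_def by simp
  have gI: "integrable M (\<lambda>\<omega>. indicat_real K \<omega> * g \<omega>)" if "K \<in> events" for K
    using integrable_mult_indicator[OF that intg] by simp
  have EI: "integrable M (\<lambda>\<omega>. indicat_real K \<omega> * indicat_real E \<omega>)" if "K \<in> events" for K
    using integrable_mult_indicator[OF that intE] by simp
  have GM: "?G \<subseteq> events" using CM BM by auto
  have sub: "sigma_sets (space M) ?G \<subseteq> events" by (rule sets.sigma_sets_subset[OF GM])
  \<comment> \<open>Conditioning on \<open>C\<close> allows the factorization of
    \<open>E \<inter> F\<close>. Since the factor formed by \<open>H\<close> and \<open>g\<close> is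
    \<open>C\<close>-measurable, the conditional probability of \<open>F\<close> can be turned back
    into its indicator.\<close>
  have base: "(\<integral>\<omega>. indicat_real (H \<inter> F) \<omega> * indicat_real E \<omega> \<partial>M) =
      (\<integral>\<omega>. indicat_real (H \<inter> F) \<omega> * g \<omega> \<partial>M)" if H: "H \<in> sets C" and F: "F \<in> sets B" for H F
  proof -
    have HM: "H \<in> events" and FM: "F \<in> events" using H F CM BM by auto
    have HC: "indicat_real H \<in> borel_measurable C" using H by simp
    have fC: "(\<lambda>\<omega>. indicat_real H \<omega> * g \<omega>) \<in> borel_measurable C" using HC gC by measurable
    have i1: "integrable M (\<lambda>\<omega>. indicat_real H \<omega> * indicat_real (E \<inter> F) \<omega>)"
      using integrable_mult_indicator[OF HM integrable_indicator_event[of "E \<inter> F"]] E FM by simp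
    have i2: "integrable M (\<lambda>\<omega>. (indicat_real H \<omega> * g \<omega>) * indicat_real F \<omega>)"
      using integrable_real_mult_indicator[OF FM gI[OF HM]] by simp
    have "(\<integral>\<omega>. indicat_real (H \<inter> F) \<omega> * indicat_real E \<omega> \<partial>M) =
        (\<integral>\<omega>. indicat_real H \<omega> * indicat_real (E \<inter> F) \<omega> \<partial>M)"
      by (rule Bochner_Integration.integral_cong) (auto simp: indicator_def)
    also have "\<dots> = (\<integral>\<omega>. indicat_real H \<omega> * real_cond_exp M C (indicat_real (E \<inter> F)) \<omega> \<partial>M)"
      using C.real_cond_exp_intg(2)[OF i1 HC] E FM by simp
    also have "\<dots> = (\<integral>\<omega>. (indicat_real H \<omega> * g \<omega>) * real_cond_exp M C (indicat_real F) \<omega> \<partial>M)"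
    proof (rule integral_cong_AE)
      show "AE \<omega> in M. indicat_real H \<omega> * real_cond_exp M C (indicat_real (E \<inter> F)) \<omega> =
          (indicat_real H \<omega> * g \<omega>) * real_cond_exp M C (indicat_real F) \<omega>"
        using indep[OF F] by eventually_elim (simp add: g_def)
    qed (use HM intg in measurable)
    also have "\<dots> = (\<integral>\<omega>. (indicat_real H \<omega> * g \<omega>) * indicat_real F \<omega> \<partial>M)"
      using C.real_cond_exp_intg(2)[OF i2 fC] FM by simp
    also have "\<dots> = (\<integral>\<omega>. indicat_real (H \<inter> F) \<omega> * g \<omega> \<partial>M)"
      by (rule Bochner_Integration.integral_cong) (auto simp: indicator_def)
    finally show ?thesis .
  qed
  \<comment> \<open>Dynkin's theorem extends \<open>base\<close> from this pi-system to the
    generated sigma-algebra: the sets with equal integrals are closed under complements and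
    countable disjoint unions.\<close>
  have "Int_stable ?G"
  proof (rule Int_stableI, clarsimp)
    fix H F H' F' assume "H \<in> sets C" "F \<in> sets B" "H' \<in> sets C" "F' \<in> sets B"
    then show "\<exists>H'' F''. H \<inter> F \<inter> (H' \<inter> F') = H'' \<inter> F'' \<and> H'' \<in> sets C \<and> F'' \<in> sets B"
      by (intro exI[of _ "H \<inter> H'"] exI[of _ "F \<inter> F'"]) auto
  qed
  moreover have "?G \<subseteq> Pow (space M)" using GM sets.space_closed by blast
  ultimately show ?thesis
    using K unfolding g_def[symmetric]
  proof (induction rule: sigma_sets_induct_disjoint)
    case (basic K)
    then show ?case using base by auto
  next
    case empty
    then show ?case by simp
  next
    case (compl K)
    then have KM: "K \<in> events" using sub by blast
    \<comment> \<open>A general \<open>h\<close> serves both sides of the equation: the indicator of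
      \<open>E\<close> and \<open>g\<close>.\<close>
    have split: "(\<integral>\<omega>. indicat_real (space M - K) \<omega> * h \<omega> \<partial>M) =
        (\<integral>\<omega>. indicat_real (space M) \<omega> * h \<omega> \<partial>M) - (\<integral>\<omega>. indicat_real K \<omega> * h \<omega> \<partial>M)"
      if "\<And>K. K \<in> events \<Longrightarrow> integrable M (\<lambda>\<omega>. indicat_real K \<omega> * h \<omega>)" for h
    proof -
      have "(\<integral>\<omega>. indicat_real (space M) \<omega> * h \<omega> \<partial>M) - (\<integral>\<omega>. indicat_real K \<omega> * h \<omega> \<partial>M) =
          (\<integral>\<omega>. indicat_real (space M) \<omega> * h \<omega> - indicat_real K \<omega> * h \<omega> \<partial>M)"
        using that[OF sets.top] that[OF KM] by simp
      also have "\<dots> = (\<integral>\<omega>. indicat_real (space M - K) \<omega> * h \<omega> \<partial>M)"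
        by (rule Bochner_Integration.integral_cong) (auto simp: indicator_def)
      finally show ?thesis by simp
    qed
    \<comment> \<open>The total integrals needed for complements agree by \<open>base\<close> for
      the whole space.\<close>
    have "space M \<in> sets C" "space M \<in> sets B" using sets.top[of C] sets.top[of B] spC spB by simp_all
    from base[OF this] show ?case
      using split[OF EI] split[OF gI] compl by simp
  next
    case (union K)
    have KM: "\<And>i. K i \<in> events" using union(2) sub by blast
    have split: "(\<integral>\<omega>. indicat_real (\<Union>i. K i) \<omega> * h \<omega> \<partial>M) =
        (\<Sum>i. \<integral>\<omega>. indicat_real (K i) \<omega> * h \<omega> \<partial>M)"
      if h: "\<And>K. K \<in> events \<Longrightarrow> integrable M (\<lambda>\<omega>. indicat_real K \<omega> * h \<omega>)" for h
    proof -
      have "set_integrable M (\<Union>i. K i) h"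
        using h[of "\<Union>i. K i"] KM by (simp add: set_integrable_def sets.countable_UN')
      from lebesgue_integral_countable_add[OF KM _ this] union(1)
      show ?thesis by (simp add: set_lebesgue_integral_def disjoint_family_on_def)
    qed
    show ?case using split[OF EI] split[OF gI] union(3) by simp
  qed
qed

text \<open>A converse to the preceding lemma that also enlarges the conditioning algebra: correct
  integrals over \<open>D\<close> make \<open>g\<close> the conditional probability of
  \<open>E\<close> given any \<open>C'\<close> between \<open>C\<close> and \<open>D\<close>, and as
  a \<open>C'\<close>-measurable factor it can be pulled out.\<close>

lemma (in prob_space) set_integral_eq_imp_cond_indep:
  assumes C': "subalgebra M C'" and CC': "subalgebra C' C" and C'D: "sets C' \<subseteq> D"
    and D: "D \<subseteq> events" and D_Int: "\<And>H F. H \<in> D \<Longrightarrow> F \<in> D \<Longrightarrow> H \<inter> F \<in> D"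
    and E: "E \<in> events" and F: "F \<in> D"
    and eq: "\<And>K. K \<in> D \<Longrightarrow> (\<integral>\<omega>. indicat_real K \<omega> * indicat_real E \<omega> \<partial>M) =
         (\<integral>\<omega>. indicat_real K \<omega> * real_cond_exp M C (indicat_real E) \<omega> \<partial>M)"
  shows "AE \<omega> in M. real_cond_exp M C' (indicat_real (E \<inter> F)) \<omega> =
          real_cond_exp M C' (indicat_real E) \<omega> * real_cond_exp M C' (indicat_real F) \<omega>"
proof -
  have C: "subalgebra M C" using C' CC' by (auto simp: subalgebra_def)
  interpret C: sigma_finite_subalgebra M C by (rule sigma_finite_subalgebraI[OF C])
  interpret C': sigma_finite_subalgebra M C' by (rule sigma_finite_subalgebraI[OF C'])
  define g where "g = real_cond_exp M C (indicat_real E)"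
  have FM: "F \<in> events" using F D by blast
  have intE: "integrable M (indicat_real E)"
    by (rule integrable_indicator_event[OF E])
  have intg: "integrable M g" unfolding g_def by (rule C.real_cond_exp_int(1)[OF intE])
  have gC': "g \<in> borel_measurable C'"
    unfolding g_def by (rule measurable_from_subalg[OF CC' borel_measurable_cond_exp])
  have gF: "integrable M (\<lambda>\<omega>. g \<omega> * indicat_real F \<omega>)"
    by (rule integrable_real_mult_indicator[OF FM intg])
  have 1: "AE \<omega> in M. real_cond_exp M C' (indicat_real E) \<omega> = g \<omega>"
  proof (rule C'.real_cond_exp_charact(1)[OF _ intE intg gC'])
    fix H assume "H \<in> sets C'"
    then show "(\<integral>\<omega>\<in>H. indicat_real E \<omega> \<partial>M) = (\<integral>\<omega>\<in>H. g \<omega> \<partial>M)"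
      using eq[of H] C'D by (auto simp: set_lebesgue_integral_def g_def)
  qed
  have 2: "AE \<omega> in M. real_cond_exp M C' (\<lambda>\<omega>. g \<omega> * indicat_real F \<omega>) \<omega> =
      g \<omega> * real_cond_exp M C' (indicat_real F) \<omega>"
    using FM by (intro C'.real_cond_exp_mult gC' gF) auto
  \<comment> \<open>Testing against \<open>H\<close> in \<open>C'\<close> amounts to integrating
    over \<open>H \<inter> F\<close>, which is still in \<open>D\<close>, so the indicator of
    \<open>E\<close> may be replaced by \<open>g\<close>.\<close>
  have 3: "AE \<omega> in M. real_cond_exp M C' (indicat_real (E \<inter> F)) \<omega> =
      real_cond_exp M C' (\<lambda>\<omega>. g \<omega> * indicat_real F \<omega>) \<omega>"
  proof (rule C'.real_cond_exp_charact(1))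
    fix H assume H: "H \<in> sets C'"
    have "(\<integral>\<omega>\<in>H. indicat_real (E \<inter> F) \<omega> \<partial>M) = (\<integral>\<omega>. indicat_real (H \<inter> F) \<omega> * indicat_real E \<omega> \<partial>M)"
      unfolding set_lebesgue_integral_def
      by (rule Bochner_Integration.integral_cong) (auto simp: indicator_def)
    also have "\<dots> = (\<integral>\<omega>. indicat_real (H \<inter> F) \<omega> * g \<omega> \<partial>M)"
      unfolding g_def using H C'D F by (intro eq D_Int) auto
    also have "\<dots> = (\<integral>\<omega>\<in>H. g \<omega> * indicat_real F \<omega> \<partial>M)"
      unfolding set_lebesgue_integral_def
      by (rule Bochner_Integration.integral_cong) (auto simp: indicator_def)
    also have "\<dots> = (\<integral>\<omega>\<in>H. real_cond_exp M C' (\<lambda>\<omega>. g \<omega> * indicat_real F \<omega>) \<omega> \<partial>M)"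
      by (rule C'.real_cond_exp_intA[OF gF H])
    finally show "(\<integral>\<omega>\<in>H. indicat_real (E \<inter> F) \<omega> \<partial>M) =
        (\<integral>\<omega>\<in>H. real_cond_exp M C' (\<lambda>\<omega>. g \<omega> * indicat_real F \<omega>) \<omega> \<partial>M)" .
  qed (use E FM C'.real_cond_exp_int(1)[OF gF] integrable_indicator_event in auto)
  from 1 2 3 show ?thesis by eventually_elim simp
qed

section \<open>Semigraphoid properties\<close>

lemma cond_indep_commute: "cond_indep N P X Z Y \<Longrightarrow> cond_indep N P Y Z X"
  unfolding cond_indep_def by (subst Int_commute, subst mult.commute) blast

lemma space_coord_algebra [simp]: "space (coord_algebra N P S) = space P"
  by (simp add: coord_algebra_def)

lemma measurable_coord_algebra_component:
  assumes P: "joint_distribution V N P" and "S \<subseteq> V" "i \<in> S"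
  shows "(\<lambda>\<omega>. \<omega> i) \<in> measurable (coord_algebra N P S) (N i)"
proof -
  have "space P = space (Pi\<^sub>M V N)"
    using P by (auto simp: joint_distribution_def dest: sets_eq_imp_space_eq)
  then have "(\<lambda>\<omega>. restrict \<omega> S) \<in> space P \<rightarrow> space (Pi\<^sub>M S N)"
    using assms(2) by (auto simp: space_PiM PiE_def Pi_def)
  then have "(\<lambda>\<omega>. restrict \<omega> S) \<in> measurable (coord_algebra N P S) (Pi\<^sub>M S N)"
    unfolding coord_algebra_def by (rule measurable_vimage_algebra1)
  from measurable_compose[OF this measurable_component_singleton[OF \<open>i \<in> S\<close>]]
  show ?thesis using \<open>i \<in> S\<close> by simp
qed

text \<open>The minimality of the generated algebra; inclusions between coordinate algebras thereby
  reduce to measurability of single coordinates.\<close>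

lemma sets_coord_algebra_subset:
  assumes "space Q = space P" and "\<And>i. i \<in> S \<Longrightarrow> (\<lambda>\<omega>. \<omega> i) \<in> measurable Q (N i)"
  shows "sets (coord_algebra N P S) \<subseteq> sets Q"
proof -
  have m: "(\<lambda>\<omega>. restrict \<omega> S) \<in> measurable Q (Pi\<^sub>M S N)"
    by (rule measurable_restrict) (rule assms(2))
  then have "(\<lambda>\<omega>. restrict \<omega> S) \<in> space P \<rightarrow> space (Pi\<^sub>M S N)"
    using measurable_space[OF m] assms(1) by auto
  then show ?thesis
    using measurable_sets[OF m] assms(1) by (auto simp: coord_algebra_def sets_vimage_algebra2)
qed

lemma sets_coord_algebra_mono:
  assumes "joint_distribution V N P" "S \<subseteq> T" "T \<subseteq> V"
  shows "sets (coord_algebra N P S) \<subseteq> sets (coord_algebra N P T)"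
  using assms by (intro sets_coord_algebra_subset measurable_coord_algebra_component) auto

lemma subalgebra_coord_algebra:
  assumes P: "joint_distribution V N P" and "S \<subseteq> V"
  shows "subalgebra P (coord_algebra N P S)"
proof -
  have "sets P = sets (Pi\<^sub>M V N)" using P by (simp add: joint_distribution_def)
  then have "(\<lambda>\<omega>. \<omega> i) \<in> measurable P (N i)" if "i \<in> S" for i
    using that \<open>S \<subseteq> V\<close> measurable_component_singleton[of i V N]
    by (auto cong: measurable_cong_sets)
  then show ?thesis
    by (simp add: subalgebra_def sets_coord_algebra_subset)
qed

text \<open>Supplies the generator for the Dynkin argument. Taking the whole space as one factor
  shows that both algebras lie in the generated one, and every coordinate of the union is measurable
  for one of them.\<close>

lemma sets_coord_algebra_Un:
  assumes P: "joint_distribution V N P" and "S \<subseteq> V" "T \<subseteq> V"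
  shows "sets (coord_algebra N P (S \<union> T)) \<subseteq> sigma_sets (space P)
    {H \<inter> F |H F. H \<in> sets (coord_algebra N P S) \<and> F \<in> sets (coord_algebra N P T)}"
proof -
  let ?S = "coord_algebra N P S" and ?T = "coord_algebra N P T"
  let ?G = "{H \<inter> F |H F. H \<in> sets ?S \<and> F \<in> sets ?T}"
  let ?Q = "sigma (space P) ?G"
  have GP: "?G \<subseteq> Pow (space P)"
    using sets.sets_into_space[of _ ?S] by fastforce
  have sp: "space P \<in> sets ?S" "space P \<in> sets ?T"
    using sets.top[of ?S] sets.top[of ?T] by simp_all
  have "H \<in> ?G" if "H \<in> sets ?S" for H
    using that sp sets.sets_into_space[OF that] by (intro CollectI exI[of _ H] exI[of _ "space P"]) auto
  then have S: "subalgebra ?Q ?S"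
    using GP by (auto simp: subalgebra_def)
  have "F \<in> ?G" if "F \<in> sets ?T" for F
    using that sp sets.sets_into_space[OF that] by (intro CollectI exI[of _ "space P"] exI[of _ F]) auto
  then have T: "subalgebra ?Q ?T"
    using GP by (auto simp: subalgebra_def)
  have "sets (coord_algebra N P (S \<union> T)) \<subseteq> sets ?Q"
  proof (rule sets_coord_algebra_subset)
    fix i assume "i \<in> S \<union> T"
    then show "(\<lambda>\<omega>. \<omega> i) \<in> measurable ?Q (N i)"
      using measurable_from_subalg[OF S measurable_coord_algebra_component[OF P \<open>S \<subseteq> V\<close>]]
        measurable_from_subalg[OF T measurable_coord_algebra_component[OF P \<open>T \<subseteq> V\<close>]] by auto
  qed (use GP in simp)
  then show ?thesis using GP by simp
qed

lemma cond_indep_subset: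
  assumes "joint_distribution V N P" "cond_indep N P X Z Y" "Y' \<subseteq> Y" "Y \<subseteq> V"
  shows "cond_indep N P X Z Y'"
  using assms(2) sets_coord_algebra_mono[OF assms(1,3,4)] unfolding cond_indep_def by blast

text \<open>The probability of an \<open>X\<close>-event given \<open>Z\<close> is also its
  probability given \<open>Z\<close>, \<open>Y\<close> and \<open>W\<close> together, and hence
  given the intermediate \<open>Z \<union> W\<close>.\<close>

lemma cond_indep_weak_union:
  assumes P: "joint_distribution V N P" and indep: "cond_indep N P X Z (Y \<union> W)"
    and V: "X \<subseteq> V" "Y \<subseteq> V" "Z \<subseteq> V" "W \<subseteq> V"
  shows "cond_indep N P X (Z \<union> W) Y"
  unfolding cond_indep_def
proof (intro ballI)
  fix E F assume E: "E \<in> sets (coord_algebra N P X)" and F: "F \<in> sets (coord_algebra N P Y)"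
  let ?D = "sets (coord_algebra N P (Z \<union> (Y \<union> W)))"
  interpret prob_space P using P by (simp add: joint_distribution_def)
  note sub = subalgebra_coord_algebra[OF P] and mono = sets_coord_algebra_mono[OF P]
  have EM: "E \<in> events" using E sub[OF V(1)] by (auto simp: subalgebra_def)
  show "AE \<omega> in P. real_cond_exp P (coord_algebra N P (Z \<union> W)) (indicat_real (E \<inter> F)) \<omega> =
      real_cond_exp P (coord_algebra N P (Z \<union> W)) (indicat_real E) \<omega> *
      real_cond_exp P (coord_algebra N P (Z \<union> W)) (indicat_real F) \<omega>"
  proof (rule set_integral_eq_imp_cond_indep[where C = "coord_algebra N P Z" and D = ?D])
    show "subalgebra P (coord_algebra N P (Z \<union> W))" using V by (intro sub) auto
    show "subalgebra (coord_algebra N P (Z \<union> W)) (coord_algebra N P Z)"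
      using mono[of Z "Z \<union> W"] V by (simp add: subalgebra_def)
    show "sets (coord_algebra N P (Z \<union> W)) \<subseteq> ?D" using V by (intro mono) auto
    show "?D \<subseteq> events" using sub[of "Z \<union> (Y \<union> W)"] V by (auto simp: subalgebra_def)
    show "F \<in> ?D" using F mono[of Y "Z \<union> (Y \<union> W)"] V by auto
    fix K assume "K \<in> ?D"
    then have "K \<in> sigma_sets (space P) {H \<inter> F |H F. H \<in> sets (coord_algebra N P Z) \<and>
        F \<in> sets (coord_algebra N P (Y \<union> W))}"
      using sets_coord_algebra_Un[OF P, of Z "Y \<union> W"] V by auto
    then show "(\<integral>\<omega>. indicat_real K \<omega> * indicat_real E \<omega> \<partial>P) =
         (\<integral>\<omega>. indicat_real K \<omega> * real_cond_exp P (coord_algebra N P Z) (indicat_real E) \<omega> \<partial>P)"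
      using indep E V unfolding cond_indep_def
      by (intro cond_indep_imp_set_integral_eq[OF sub sub EM]) auto
  qed (use EM in auto)
qed

text \<open>One use of composition per added vertex. The axiom merges third arguments, so
  \<open>D\<close> stands there and \<open>R\<close> comes first.\<close>

lemma cond_indep_composition_Union:
  assumes comp: "composition_axiom V N P" and "finite D" "D \<noteq> {}"
    and V: "D \<subseteq> V" "Z \<subseteq> V" "R \<subseteq> V"
    and disj: "D \<inter> Z = {}" "D \<inter> R = {}" "Z \<inter> R = {}"
    and indep: "\<And>y. y \<in> D \<Longrightarrow> cond_indep N P R Z {y}"
  shows "cond_indep N P R Z D"
  using \<open>finite D\<close> \<open>D \<noteq> {}\<close> V(1) disj(1,2) indep
proof (induction D rule: finite_ne_induct)
  case (singleton y)
  then show ?case by simp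
next
  case (insert y D)
  then have "cond_indep N P R Z {y}" "cond_indep N P R Z D" by auto
  moreover have "{y} \<subseteq> V" "D \<subseteq> V" "R \<inter> {y} = {}" "R \<inter> Z = {}" "R \<inter> D = {}"
    "{y} \<inter> Z = {}" "{y} \<inter> D = {}" "Z \<inter> D = {}"
    using insert.prems insert.hyps disj(3) by blast+
  ultimately have "cond_indep N P R Z ({y} \<union> D)"
    using comp[unfolded composition_axiom_def, THEN spec, THEN spec, THEN spec, THEN spec,
        of R "{y}" Z D] V by simp
  then show ?case by simp
qed

section \<open>The Markov blanket\<close>

lemma parents_induced:
  assumes "ancestral G A" "v \<in> A"
  shows "parents (induced G A) v = parents G v"
  using assms by (auto simp: parents_def induced_def ancestral_def ancestors_def)

lemma district_induced_subset:
  assumes "x \<in> A"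
  shows "district (induced G A) x \<subseteq> A \<inter> district G x"
proof
  fix v assume "v \<in> district (induced G A) x"
  then have v: "(v, x) \<in> (bidir G \<inter> A \<times> A)\<^sup>*"
    by (simp add: district_def induced_def)
  then have "(v, x) \<in> (bidir G)\<^sup>*" by (rule rtrancl_mono[THEN subsetD, rotated]) auto
  moreover have "v \<in> A" using v assms by (auto elim: converse_rtranclE)
  ultimately show "v \<in> A \<inter> district G x" by (simp add: district_def)
qed

lemma district_induced_closed:
  assumes "v \<in> district (induced G A) x" "(s, v) \<in> bidir G" "s \<in> A" "v \<in> A"
  shows "s \<in> district (induced G A) x"
  using assms by (auto simp: district_def induced_def intro: converse_rtrancl_into_rtrancl)

context consecutive_district
begin

lemma cond_indep_markov_blanket:
  fixes N :: "'v \<Rightarrow> 'a measure"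
  assumes P: "joint_distribution (verts G) N P"
    and comp: "composition_axiom (verts G) N P"
    and local: "\<And>y. y \<in> district G x \<inter> pre r x \<Longrightarrow>
      cond_indep N P {y} (parents G y) (verts G - f_set G y)"
    and anc: "ancestral G A" and xA: "x \<in> A" and A_pre: "A \<subseteq> pre r x"
  shows "cond_indep N P {x} (markov_blanket G x A) (A - (markov_blanket G x A \<union> {x}))"
proof -
  define D where "D = district (induced G A) x"
  define Q where "Q = (\<Union>v \<in> D. parents G v)"
  define R where "R = A - (Q \<union> D)"
  have xD: "x \<in> D" by (simp add: D_def district_def)
  have DA: "D \<subseteq> A" and Dd: "D \<subseteq> district G x"
    using district_induced_subset[OF xA] by (auto simp: D_def)
  have AV: "A \<subseteq> verts G" using anc by (simp add: ancestral_def)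
  have closed: "a \<in> A" if "(a, b) \<in> (dir G)\<^sup>*" "b \<in> A" for a b
    using anc that by (auto simp: ancestral_def ancestors_def)
  have QA: "Q \<subseteq> A"
    using DA closed by (auto simp: Q_def parents_def)
  \<comment> \<open>A common vertex would give a directed edge between two members of the block.
    Composition requires this disjointness.\<close>
  have QD: "D \<inter> Q = {}"
  proof -
    have "D \<subseteq> district G x \<inter> pre r x" using Dd DA A_pre by blast
    then show ?thesis using no_edge by (auto simp: Q_def parents_def)
  qed
  have mb: "markov_blanket G x A = Q \<union> (D - {x})"
  proof -
    have "(\<Union>v \<in> D. parents (induced G A) v) = Q"
      unfolding Q_def using parents_induced[OF anc] DA by (intro SUP_cong) auto
    then show ?thesis by (simp add: markov_blanket_def D_def)
  qed
  \<comment> \<open>A spouse of \<open>y\<close> with a descendant in \<open>A\<close> is in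
    \<open>A\<close> by ancestrality, hence in \<open>D\<close>; a directed path from
    \<open>D\<close> that ends in \<open>A\<close> is trivial.\<close>
  have f: "f_set G y \<inter> A \<subseteq> parents G y \<union> D" if y: "y \<in> D" for y
  proof
    fix v assume "v \<in> f_set G y \<inter> A"
    then have "v \<in> A" and "v \<in> parents G y \<or>
        (\<exists>s. (s = y \<or> (s, y) \<in> bidir G) \<and> (s, v) \<in> (dir G)\<^sup>*)"
      unfolding f_set_def spouses_def descendants_def by auto
    then consider "v \<in> parents G y"
      | s where "s = y \<or> (s, y) \<in> bidir G" "(s, v) \<in> (dir G)\<^sup>*" "v \<in> A"
      by blast
    then show "v \<in> parents G y \<union> D"
    proof cases
      case 2
      have "s \<in> A" using closed 2 by blast
      then have "s \<in> D"
        using 2(1) y district_induced_closed[of y G A x s] DA by (auto simp: D_def)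
      then have "s = v"
        using no_directed_path_from_district[OF _ 2(2)] Dd A_pre 2(3) by auto
      then show ?thesis using \<open>s \<in> D\<close> by simp
    qed simp
  qed
  have "cond_indep N P R Q {y}" if y: "y \<in> D" for y
  proof (rule cond_indep_commute)
    have yb: "y \<in> district G x \<inter> pre r x" using y Dd DA A_pre by auto
    have yQ: "parents G y \<subseteq> Q" using y by (auto simp: Q_def)
    \<comment> \<open>The surplus \<open>Q - parents G y\<close> is carried along so that weak union
      can move it behind the bar, which gives all \<open>y\<close> in \<open>D\<close> the same
      conditioning set \<open>Q\<close>.\<close>
    have "R \<union> (Q - parents G y) \<subseteq> verts G - f_set G y"
      using f[OF y] QA AV QD yQ by (auto simp: R_def)
    then have "cond_indep N P {y} (parents G y) (R \<union> (Q - parents G y))"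
      by (rule cond_indep_subset[OF P local[OF yb]]) auto
    then have "cond_indep N P {y} (parents G y \<union> (Q - parents G y)) R"
      using y DA AV QA yQ by (intro cond_indep_weak_union[OF P]) (auto simp: R_def)
    moreover have "parents G y \<union> (Q - parents G y) = Q" using yQ by auto
    ultimately show "cond_indep N P {y} Q R" by simp
  qed
  moreover have "finite D"
    using admg DA AV by (auto simp: admg_def intro: finite_subset)
  ultimately have "cond_indep N P R Q D"
    using xD DA AV QA QD
    by - (rule cond_indep_composition_Union[OF comp]; auto simp: R_def)
  moreover have "{x} \<union> (D - {x}) = D" using xD by auto
  ultimately have "cond_indep N P R Q ({x} \<union> (D - {x}))" by simp
  \<comment> \<open>Weak union with \<open>D - {x}\<close> as the moved part completes
    \<open>Q\<close> to the Markov blanket; symmetry then restores the order of the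
    arguments.\<close>
  then have "cond_indep N P R (Q \<union> (D - {x})) {x}"
    using xA DA AV QA by (intro cond_indep_weak_union[OF P]) (auto simp: R_def)
  moreover have "A - (markov_blanket G x A \<union> {x}) = R"
    using xD by (auto simp: mb R_def)
  ultimately show ?thesis
    unfolding mb by (metis cond_indep_commute)
qed

end

theorem lemma1:
  fixes G :: "'v mixed_graph" and r :: "('v \<times> 'v) set" and x :: 'v
  assumes "admg G"
    and "vertex_ordering G r"
    and "consistent G r"
    and "x \<in> verts G"
    and "consecutive G r (district G x \<inter> pre r x)"
    and "\<forall>a \<in> district G x \<inter> pre r x. \<forall>b \<in> district G x \<inter> pre r x. (a, b) \<notin> dir G"
  shows "(\<forall>y \<in> district G x \<inter> pre r x.
            m_separated_set G y (verts G - f_set G y) (parents G y)) \<and>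
         (\<forall>(N :: 'v \<Rightarrow> 'a measure) P.
            joint_distribution (verts G) N P \<longrightarrow>
            composition_axiom (verts G) N P \<longrightarrow>
            (\<forall>y \<in> district G x \<inter> pre r x.
               cond_indep N P {y} (parents G y) (verts G - f_set G y)) \<longrightarrow>
            (\<forall>A. maximal_ancestral G r x A \<longrightarrow>
               cond_indep N P {x} (markov_blanket G x A) (A - (markov_blanket G x A \<union> {x}))))"
proof -
  interpret consecutive_district G r x
    by unfold_locales (fact assms)+
  show ?thesis
  proof (intro conjI ballI allI impI)
    fix y assume "y \<in> district G x \<inter> pre r x"
    then show "m_separated_set G y (verts G - f_set G y) (parents G y)"
      by (rule m_separated_parents)
  next
    fix N :: "'v \<Rightarrow> 'a measure" and P A
    assume "joint_distribution (verts G) N P" "composition_axiom (verts G) N P"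
      "\<forall>y \<in> district G x \<inter> pre r x. cond_indep N P {y} (parents G y) (verts G - f_set G y)"
      "maximal_ancestral G r x A"
    then show "cond_indep N P {x} (markov_blanket G x A) (A - (markov_blanket G x A \<union> {x}))"
      unfolding maximal_ancestral_def by (intro cond_indep_markov_blanket) blast+
  qed
qed

end
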